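(* Let $\psi_u$ be the adapter parameters trained on user data $\mathcal{D}_u$, with bounded value range $[-C,C]$ and quantization resolution $\delta$. Then the information leakage $I(\psi_u;\mathcal{D}_u)$ is upper bounded by \[ I(\psi_u;\mathcal{D}_u)\;\le\; fd\cdot\log\!\left(\frac{2C}{\delta}\right), \] where $d$ is the bottleneck dimension in the adapter and the adapter $\psi_u$ is an $f\times d$ matrix of parameters.
   Context: In federated recommendation, each user (client) $u$ holds local private data $\mathcal{D}_u$ consisting of interactions $(u,i,y_{ui})$ between the user and items $i$, and trains a local adapter $\psi_u$ on top of a frozen pre-trained item representation model. In the linearized setting, the item representation model is a matrix in $\mathbb{R}^{L\times f}$ (with $L$ the input length and $f$ the embedding size) and the adapter of client $u$ is a matrix in $\mathbb{R}^{f\times d}$. "Bounded value range $[-C,C]$ and quantization resolution $\delta$" means that the adapter parameters take values in $[-C,C]$ and are quantized at resolution $\delta$. $I(X;Y)$ denotes the mutual information between $X$ and $Y$; here it measures how much information about the user's data is leaked by the adapter parameters.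
   Formalization: Assumes δ ≤ 2C (otherwise the bound is negative and fails) and reads quantization at resolution δ as using only the ⌊2C/δ⌋ full cells of width δ in [-C,C], one value per cell; with the closed grid of 2C/δ + 1 values the bound is false. *)

theory Defs
  imports "HOL-Probability.Probability"
begin

text \<open>
  The possible local data sets of a client: finite sets of interactions between that client
  and items, each interaction carrying a label.
\<close>

definition user_datasets :: "'u \<Rightarrow> ('u \<times> 'i \<times> 'y) set set" where
  "user_datasets u = {D. finite D \<and> (\<forall>(v, i, y)\<in>D. v = u)}"

text \<open>
  Uniform quantization of \<open>[-C, C]\<close> at resolution \<open>\<delta>\<close>: the range is divided into consecutive
  cells of width \<open>\<delta>\<close>, and all parameters in one cell are stored as the same representative,
  taken from that cell.  Midpoints, left end points or right end points are all admissible.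
  Only the \<open>\<lfloor>2 * C / \<delta>\<rfloor>\<close> full cells are used and the quantizer saturates at the top one, so that
  \<open>x = C\<close> (and a remainder shorter than \<open>\<delta>\<close>, if \<open>\<delta>\<close> does not divide \<open>2 * C\<close>) goes into the last
  full cell.
\<close>

definition quantization_cell :: "real \<Rightarrow> real \<Rightarrow> int \<Rightarrow> real set" where
  "quantization_cell C \<delta> k = {- C + of_int k * \<delta> .. - C + (of_int k + 1) * \<delta>}"

definition cell_index :: "real \<Rightarrow> real \<Rightarrow> real \<Rightarrow> int" where
  "cell_index C \<delta> x = min \<lfloor>(x + C) / \<delta>\<rfloor> (\<lfloor>2 * C / \<delta>\<rfloor> - 1)"

definition uniform_quantizer :: "real \<Rightarrow> real \<Rightarrow> (real \<Rightarrow> real) \<Rightarrow> bool" where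
  "uniform_quantizer C \<delta> q \<longleftrightarrow>
     (\<exists>rep. (\<forall>k\<in>{0..<\<lfloor>2 * C / \<delta>\<rfloor>}. rep k \<in> quantization_cell C \<delta> k) \<and>
            (\<forall>x\<in>{-C..C}. q x = rep (cell_index C \<delta> x)))"

text \<open>
  \<open>train (D, r)\<close> is the adapter obtained from data \<open>D\<close> when the other inputs of the training
  procedure (initialization, mini-batch order, messages of the server, ...) are \<open>r\<close>.  The
  trained parameters lie in \<open>[-C, C]\<close> and are stored in quantized form.
\<close>

definition quantized_adapter ::
  "(real \<Rightarrow> real) \<Rightarrow> ('data \<times> 'r \<Rightarrow> real^'d^'f) \<Rightarrow> ('w \<Rightarrow> 'data) \<Rightarrow> ('w \<Rightarrow> 'r) \<Rightarrow> 'w \<Rightarrow> real^'d^'f"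
where
  "quantized_adapter q train D R = (\<lambda>\<omega>. map_matrix q (train (D \<omega>, R \<omega>)))"

end

theory Submission
  imports Defs
begin

text \<open>
  If \<open>X\<close> takes values in a finite set \<open>V\<close>, the joint law of \<open>(X, Y)\<close> has density at most
  \<open>g (v, y) = 1 / P (X = v)\<close> with respect to the product of the marginals, because
  \<open>P (X = v, Y \<in> B) \<le> P (Y \<in> B)\<close>.  The mean of \<open>g\<close> under the joint law is at most \<open>card V\<close>, so
  concavity of the logarithm gives \<open>I (X; Y) \<le> log (card V)\<close>.
  Each entry of a quantized adapter takes at most \<open>2 * C / \<delta>\<close> values.
\<close>

lemma (in information_space) mutual_information_le_log_card:
  fixes X :: "'a \<Rightarrow> 'c"
  assumes X[measurable]: "X \<in> measurable M S" and Y[measurable]: "Y \<in> measurable M T"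
    and fin: "finite V" and range: "X ` space M \<subseteq> V"
    and V: "\<And>v. v \<in> V \<Longrightarrow> {v} \<in> sets S"
  shows "mutual_information b S T X Y \<le> log b (card V)"
proof -
  define P where "P = distr M S X \<Otimes>\<^sub>M distr M T Y"
  define Q where "Q = distr M (S \<Otimes>\<^sub>M T) (\<lambda>x. (X x, Y x))"
  define p where "p v = measure (distr M S X) {v}" for v :: 'c
  define R where "R v = {v} \<times> space T" for v :: 'c
  define g where "g z = (\<Sum>v\<in>V. indicator (R v) z * (1 / p v))" for z
  interpret X: prob_space "distr M S X" by (rule prob_space_distr) fact
  interpret Y: prob_space "distr M T Y" by (rule prob_space_distr) fact
  interpret XY: pair_prob_space "distr M S X" "distr M T Y" ..
  interpret P: prob_space P unfolding P_def by unfold_locales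
  interpret Q: prob_space Q unfolding Q_def by (rule prob_space_distr) simp
  have setsP: "sets P = sets (S \<Otimes>\<^sub>M T)" and setsQ: "sets Q = sets (S \<Otimes>\<^sub>M T)"
    by (auto simp: P_def Q_def cong: sets_pair_measure_cong)
  have R[measurable]: "R v \<in> sets P" "R v \<in> sets Q" if "v \<in> V" for v
    using V[OF that] unfolding setsP setsQ R_def by auto
  have disj: "disjoint_family_on R V"
    by (auto simp: disjoint_family_on_def R_def)
  have [measurable]: "g \<in> borel_measurable P" "g \<in> borel_measurable Q"
    unfolding g_def by (measurable; simp)+
  have "V \<noteq> {}" using range not_empty by auto
  then have card: "card V \<ge> 1" using fin by (simp add: Suc_leI card_gt_0_iff)

  \<comment> \<open>The slices need not cover the product space, but \<open>Q\<close> is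
    concentrated on them because \<open>X\<close> takes values in \<open>V\<close> only.\<close>
  have split_Q: "measure Q A = (\<Sum>v\<in>V. measure Q (A \<inter> R v))" if "A \<in> sets Q" for A
  proof -
    have "measure Q A = measure Q (\<Union>v\<in>V. A \<inter> R v)"
    proof (rule Q.finite_measure_eq_AE)
      have "AE x in M. (X x, Y x) \<in> (\<Union>v\<in>V. R v)"
        by (rule AE_I2) (use range measurable_space[OF Y] in \<open>auto simp: R_def\<close>)
      moreover have [measurable]: "(\<Union>v\<in>V. R v) \<in> sets (S \<Otimes>\<^sub>M T)"
        using R(2) fin unfolding setsQ by (intro sets.finite_UN) auto
      have "{z \<in> space (S \<Otimes>\<^sub>M T). z \<in> (\<Union>v\<in>V. R v)} \<in> sets (S \<Otimes>\<^sub>M T)"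
        by measurable
      ultimately have "AE z in Q. z \<in> (\<Union>v\<in>V. R v)"
        unfolding Q_def by (simp only: AE_distr_iff[OF measurable_Pair[OF X Y]])
      then show "AE z in Q. (z \<in> A) = (z \<in> (\<Union>v\<in>V. A \<inter> R v))"
        by eventually_elim auto
    qed (use that R(2) fin in \<open>auto simp del: UN_simps\<close>)
    also have "\<dots> = (\<Sum>v\<in>V. measure Q (A \<inter> R v))"
      using that R(2) fin disj
      by (intro Q.finite_measure_finite_Union) (auto simp: disjoint_family_on_def)
    finally show ?thesis .
  qed

  have Q_R: "measure Q (R v) = p v" if "v \<in> V" for v
  proof -
    have "(\<lambda>x. (X x, Y x)) -` R v \<inter> space M = X -` {v} \<inter> space M"
      using measurable_space[OF Y] by (auto simp: R_def)
    then show ?thesis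
      using R(2)[OF that] V[OF that] unfolding setsQ by (simp add: Q_def p_def measure_distr)
  qed

  have le: "measure Q (A \<inter> R v) \<le> measure P (A \<inter> R v) * (1 / p v)"
    if A: "A \<in> sets P" and v: "v \<in> V" for A v
  proof (cases "p v = 0")
    case True
    have "measure Q (A \<inter> R v) \<le> measure Q (R v)"
      using A R[OF v] by (intro Q.finite_measure_mono) (auto simp: setsP setsQ)
    then show ?thesis using True Q_R[OF v] by simp
  next
    case False
    define B where "B = Pair v -` A"
    have A': "A \<in> sets (S \<Otimes>\<^sub>M T)" using A by (simp add: setsP)
    have [measurable]: "B \<in> sets T" unfolding B_def by (rule sets_Pair1[OF A'])
    \<comment> \<open>Over a single point even an arbitrary \<open>A\<close> cuts out a rectangle,
      with \<open>B\<close> the section of \<open>A\<close> at \<open>v\<close>; hence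
      \<open>P\<close> factorizes on it.\<close>
    have AR: "A \<inter> R v = {v} \<times> B"
      using sets.sets_into_space[OF A'] by (auto simp: B_def R_def space_pair_measure)
    have "measure P (A \<inter> R v) = p v * measure (distr M T Y) B"
      using V[OF v] unfolding AR P_def p_def
      by (simp add: measure_def Y.emeasure_pair_measure_Times enn2real_mult)
    moreover have "measure Q (A \<inter> R v) \<le> measure (distr M T Y) B"
      using V[OF v] unfolding AR Q_def
      by (auto simp: measure_distr intro!: finite_measure_mono)
    ultimately show ?thesis using False by simp
  qed

  have ac: "absolutely_continuous P Q"
    unfolding absolutely_continuous_def
  proof
    fix A assume A: "A \<in> null_sets P"
    then have A': "A \<in> sets P" "A \<in> sets Q" by (auto simp: setsP setsQ)
    have "measure P (A \<inter> R v) = 0" if "v \<in> V" for v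
      using null_set_Int2[OF A R(1)[OF that]] by (auto simp: measure_def)
    then have "measure Q A \<le> 0"
      unfolding split_Q[OF A'(2)] using le[OF A'(1)] by (intro sum_nonpos) simp
    then show "A \<in> null_sets Q"
      using A' by (auto simp: null_sets_def Q.emeasure_eq_measure measure_le_0_iff)
  qed
  \<comment> \<open>A real-valued version of the density, positive \<open>Q\<close>-almost
    everywhere, so that logarithms can be compared pointwise.\<close>
  obtain f where f[measurable]: "f \<in> borel_measurable P"
    and f_RN: "AE z in P. RN_deriv P Q z = ennreal (f z)"
    and f_pos: "AE z in Q. 0 < f z" and f_nn: "\<And>z. 0 \<le> f z"
    using P.real_RN_deriv[OF Q.finite_measure_axioms ac] setsP setsQ by metis
  have fQ[measurable]: "f \<in> borel_measurable Q" 
    using f by (simp add: measurable_cong_sets[OF trans[OF setsP setsQ[symmetric]] refl])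
  have Q_f: "Q = density P f"
    using P.density_RN_deriv[OF ac] f_RN setsP setsQ density_cong[OF _ _ f_RN] by simp
  have int_f: "integrable P f"
    using Q.emeasure_space_1 f_nn unfolding Q_f
    by (intro integrableI_nonneg) (auto simp: emeasure_density cong: nn_integral_cong)
  have int_g: "integrable P g" "integrable Q g"
    unfolding g_def using R by (auto simp: less_top[symmetric])

  \<comment> \<open>The bound on sets becomes a pointwise one: over every measurable
    \<open>A\<close> the integral of \<open>f\<close> is the \<open>Q\<close>-measure of
    \<open>A\<close>, which is at most the integral of \<open>g\<close>.\<close>
  have "AE z in P. 0 \<le> g z - f z"
  proof (rule P.density_nonneg)
    show "integrable P (\<lambda>z. g z - f z)" using int_f int_g by simp
    fix A assume A: "A \<in> sets P"
    then have A': "A \<in> sets Q" by (simp add: setsP setsQ)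
    have "(LINT z:A|P. f z) = measure Q A"
      using A A' f_nn Q.emeasure_eq_measure
      using integral_density[of "indicator A :: _ \<Rightarrow> real" P f] 
      by (simp add: Q_f[symmetric] set_lebesgue_integral_def mult.commute)
    also have "\<dots> \<le> (\<Sum>v\<in>V. measure P (A \<inter> R v) * (1 / p v))"
      unfolding split_Q[OF A'] by (intro sum_mono le A)
    also have "\<dots> = (LINT z:A|P. g z)"
    proof -
      have "(LINT z:A|P. g z) = (LINT z|P. (\<Sum>v\<in>V. indicator (A \<inter> R v) z * (1 / p v)))"
        by (simp add: set_lebesgue_integral_def g_def sum_distrib_left indicator_inter_arith mult.assoc)
      then show ?thesis
        using A R by (subst (asm) Bochner_Integration.integral_sum) (auto simp: less_top[symmetric])
    qed
    finally show "0 \<le> (LINT z:A|P. g z - f z)"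
      using integrable_mult_indicator[OF A int_f] integrable_mult_indicator[OF A int_g(1)]
      by (subst set_integral_diff(2)) (simp_all add: set_integrable_def)
  qed
  \<comment> \<open>Mutual information integrates against \<open>Q\<close>, so the bound is carried
    over from \<open>P\<close> by absolute continuity.\<close>
  then have f_le: "AE z in Q. f z \<le> g z"
    using absolutely_continuous_AE[OF _ ac, of "\<lambda>z. f z \<le> g z"] setsP setsQ by simp

  have "mutual_information b S T X Y = (LINT z|Q. log b (f z))"
    unfolding mutual_information_def KL_divergence_def P_def[symmetric] Q_def[symmetric]
  proof (rule integral_cong_AE)
    show "AE z in Q. entropy_density b P Q z = log b (f z)"
      using absolutely_continuous_AE[OF _ ac f_RN] setsP setsQ f_nn
      by (auto simp: entropy_density_def)
    show "entropy_density b P Q \<in> borel_measurable Q"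
      using measurable_entropy_density[of b P Q]
      by (simp add: measurable_cong_sets[OF trans[OF setsP setsQ[symmetric]] refl])
  qed measurable
  also have "\<dots> \<le> log b (card V)"
  proof (cases "integrable Q (\<lambda>z. log b (f z))")
    case True
    \<comment> \<open>The majorant is the tangent to \<open>log b\<close> at \<open>card V\<close>,
      evaluated at \<open>g z\<close>. It is affine in \<open>g\<close>, so only the mean of
      \<open>g\<close> matters.\<close>
    have "(LINT z|Q. log b (f z)) \<le> (LINT z|Q. log b (card V) + (g z / card V - 1) / ln b)"
    proof (rule integral_mono_AE[OF True])
      show "integrable Q (\<lambda>z. log b (card V) + (g z / card V - 1) / ln b)"
        using int_g by simp
      show "AE z in Q. log b (f z) \<le> log b (card V) + (g z / card V - 1) / ln b"
        using f_pos f_le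
      proof eventually_elim
        case (elim z)
        have "ln (f z) - ln (card V) \<le> f z / card V - 1"
          using elim card ln_le_minus_one[of "f z / card V"] by (simp add: ln_div)
        also have "\<dots> \<le> g z / card V - 1"
          using elim card by (simp add: divide_right_mono)
        finally show ?case
          using b_gt_1 by (simp add: log_def field_simps)
      qed
    qed
    also have "\<dots> = log b (card V) + ((LINT z|Q. g z) / card V - 1) / ln b"
      using int_g by (simp add: Q.prob_space)
    also have "(LINT z|Q. g z) = (\<Sum>v\<in>V. p v * (1 / p v))"
      unfolding g_def using R Q_R by (subst Bochner_Integration.integral_sum) (auto simp: less_top[symmetric])
    also have "log b (card V) + ((\<Sum>v\<in>V. p v * (1 / p v)) / card V - 1) / ln b \<le> log b (card V)"
    proof -
      \<comment> \<open>Each term is \<open>1\<close>, or \<open>0\<close> when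
        \<open>p v = 0\<close>.\<close>
      have "(\<Sum>v\<in>V. p v * (1 / p v)) \<le> (\<Sum>v\<in>V. 1)"
        by (intro sum_mono) simp
      then show ?thesis
        using card b_gt_1 by (simp add: divide_le_0_iff field_simps)
    qed
    finally show ?thesis .
  next
    case False \<comment> \<open>the Bochner integral is then \<open>0\<close> by convention\<close>
    then show ?thesis using card b_gt_1 by (simp add: not_integrable_integral_eq)
  qed
  finally show ?thesis .
qed

text \<open>Uncurrying identifies matrices with functions on pairs of indices. After taking
  logarithms, the exponent becomes the factor in front of the final bound.\<close>

lemma matrices_with_entries_in:
  assumes "finite E"
  shows "finite {A :: 'a^'d^'f. \<forall>i j. A $ i $ j \<in> E}"
    and "card {A :: 'a^'d^'f. \<forall>i j. A $ i $ j \<in> E} = card E ^ (CARD('f) * CARD('d))"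
proof -
  let ?F = "(UNIV :: ('f \<times> 'd) set) \<rightarrow>\<^sub>E E"
  have "bij_betw (\<lambda>A (i, j). A $ i $ j) {A :: 'a^'d^'f. \<forall>i j. A $ i $ j \<in> E} ?F"
    by (rule bij_betw_byWitness[where f' = "\<lambda>h. \<chi> i j. h (i, j)"]) (auto simp: PiE_UNIV_domain)
  moreover have "finite ?F" using assms by (intro finite_PiE) auto
  moreover have "card ?F = card E ^ (CARD('f) * CARD('d))"
    by (simp add: card_PiE)
  ultimately show "finite {A :: 'a^'d^'f. \<forall>i j. A $ i $ j \<in> E}"
    and "card {A :: 'a^'d^'f. \<forall>i j. A $ i $ j \<in> E} = card E ^ (CARD('f) * CARD('d))"
    by (simp_all add: bij_betw_finite bij_betw_same_card)
qed

text \<open>The Euclidean basis of the matrix space consists of the matrices with one entry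
  \<open>1\<close> and zeros elsewhere, so coordinates are entries.\<close>

lemma borel_measurable_matrix_iff:
  fixes F :: "'w \<Rightarrow> real^'d^'f"
  shows "F \<in> borel_measurable M \<longleftrightarrow> (\<forall>i j. (\<lambda>\<omega>. F \<omega> $ i $ j) \<in> borel_measurable M)"
  by (subst borel_measurable_euclidean_space) (auto simp: Basis_vec_def inner_axis)

text \<open>Since \<delta> \<le> \<open>2 * C\<close>, there is at least one full cell, so capping
  at the top index cannot produce a negative one.\<close>

lemma cell_index_in_range:
  assumes "0 < \<delta>" "\<delta> \<le> 2 * C" "x \<in> {-C..C}"
  shows "cell_index C \<delta> x \<in> {0..<\<lfloor>2 * C / \<delta>\<rfloor>}"
proof -
  have "1 \<le> \<lfloor>2 * C / \<delta>\<rfloor>" using assms by (simp add: le_floor_iff)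
  moreover have "0 \<le> \<lfloor>(x + C) / \<delta>\<rfloor>" using assms by simp
  ultimately show ?thesis by (simp add: cell_index_def)
qed

text \<open>With a discrete target, an arbitrary choice of representatives can be applied to the
  index without losing measurability.\<close>

lemma measurable_cell_index[measurable]: "cell_index C \<delta> \<in> borel \<rightarrow>\<^sub>M count_space UNIV"
  unfolding cell_index_def[abs_def] by measurable

theorem theorem2:
  fixes M :: "'w measure"
    and T :: "('u \<times> 'i \<times> 'y) set measure"
    and S :: "'r measure"
    and u :: 'u
    and D :: "'w \<Rightarrow> ('u \<times> 'i \<times> 'y) set"
    and R :: "'w \<Rightarrow> 'r"
    and train :: "('u \<times> 'i \<times> 'y) set \<times> 'r \<Rightarrow> real^'d^'f"
    and q :: "real \<Rightarrow> real"
    and \<psi> :: "'w \<Rightarrow> real^'d^'f"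
    and b C \<delta> :: real
  assumes "prob_space M"
    and "b > 1"
    and "space T = user_datasets u"
    and "D \<in> measurable M T"
    and "R \<in> measurable M S"
    and "train \<in> borel_measurable (T \<Otimes>\<^sub>M S)"
    and "0 < \<delta>" and "\<delta> \<le> 2 * C"
    and "\<And>\<omega> i j. \<omega> \<in> space M \<Longrightarrow> train (D \<omega>, R \<omega>) $ i $ j \<in> {-C..C}"
    and "uniform_quantizer C \<delta> q"
    and "\<psi> = quantized_adapter q train D R"
  shows "prob_space.mutual_information M b borel T \<psi> D
           \<le> real (CARD('f) * CARD('d)) * log b (2 * C / \<delta>)"
proof -
  interpret prob_space M by fact
  interpret information_space M b by standard fact
  note [measurable] = \<open>D \<in> measurable M T\<close> \<open>R \<in> measurable M S\<close> \<open>train \<in> borel_measurable (T \<Otimes>\<^sub>M S)\<close>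
  \<comment> \<open>\<open>n\<close> counts the full cells; rounding down keeps it at most
    \<open>2 * C / \<delta>\<close>.\<close>
  define n where "n = nat \<lfloor>2 * C / \<delta>\<rfloor>"
  have n: "1 \<le> n" "real n \<le> 2 * C / \<delta>"
    using assms(7,8) by (auto simp: n_def le_nat_iff le_floor_iff)
  obtain rep where q: "q x = rep (cell_index C \<delta> x)" if "x \<in> {-C..C}" for x
    using assms(10) unfolding uniform_quantizer_def by auto
  define E where "E = rep ` {0..<\<lfloor>2 * C / \<delta>\<rfloor>}"
  define V where "V = {A :: real^'d^'f. \<forall>i j. A $ i $ j \<in> E}"
  have "finite E" by (simp add: E_def)
  \<comment> \<open>Neighbouring cells share an end point and may have the same representative, so
    equality can fail.\<close>
  have "card E \<le> n" unfolding E_def n_def using card_image_le[of "{0..<\<lfloor>2 * C / \<delta>\<rfloor>}" rep] by simp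
  have \<psi>: "\<psi> \<omega> $ i $ j = rep (cell_index C \<delta> (train (D \<omega>, R \<omega>) $ i $ j))"
    if "\<omega> \<in> space M" for \<omega> i j
    using q assms(9)[OF that] by (simp add: assms(11) quantized_adapter_def map_matrix_def)
  have V: "\<psi> ` space M \<subseteq> V"
    using \<psi> cell_index_in_range[OF assms(7,8) assms(9)] by (auto simp: V_def E_def)
  have "(\<lambda>\<omega>. train (D \<omega>, R \<omega>)) \<in> borel_measurable M" by measurable
  then have [measurable]: "(\<lambda>\<omega>. train (D \<omega>, R \<omega>) $ i $ j) \<in> borel_measurable M" for i j
    unfolding borel_measurable_matrix_iff by blast
  \<comment> \<open>\<open>q\<close> is specified on \<open>[-C, C]\<close> only, so measurability
    of \<open>\<psi>\<close> is derived from the cell indices of the trained entries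
    instead.\<close>
  have "(\<lambda>\<omega>. rep (cell_index C \<delta> (train (D \<omega>, R \<omega>) $ i $ j))) \<in> borel_measurable M" for i j
    by measurable
  then have [measurable]: "\<psi> \<in> borel_measurable M"
    unfolding borel_measurable_matrix_iff by (simp add: \<psi> cong: measurable_cong)
  have cardV: "card V = card E ^ (CARD('f) * CARD('d))" and "finite V"
    unfolding V_def using matrices_with_entries_in[OF \<open>finite E\<close>] by auto
  \<comment> \<open>Monotonicity of the logarithm needs a positive argument; \<open>V\<close>
    contains a value of \<open>\<psi>\<close> because a probability space has a point.\<close>
  have "V \<noteq> {}" using V not_empty by auto
  then have "0 < card V" using \<open>finite V\<close> by (simp add: card_gt_0_iff)
  have "mutual_information b borel T \<psi> D \<le> log b (card V)"
    by (rule mutual_information_le_log_card) (use \<open>finite V\<close> V in auto)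
  also have "\<dots> \<le> log b ((2 * C / \<delta>) ^ (CARD('f) * CARD('d)))"
  proof -
    have "real (card V) \<le> (2 * C / \<delta>) ^ (CARD('f) * CARD('d))"
      unfolding cardV of_nat_power using n \<open>card E \<le> n\<close> by (intro power_mono) auto
    then show ?thesis using \<open>0 < card V\<close> b_gt_1 by (simp add: log_mono)
  qed
  also have "\<dots> = real (CARD('f) * CARD('d)) * log b (2 * C / \<delta>)"
    using assms(7,8) by (intro log_nat_power) simp
  finally show ?thesis .
qed

end
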